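(* Consider the full discretization $$\mathbf i\,\delta_t^+u_j^n+\frac{\delta W_n}{\delta t}\,\delta_x^+\delta_x^-u_j^{n+\frac12}+|u_j^{n+\frac12}|^{2\sigma}u_j^{n+\frac12}=0,\qquad 1\le j\le N_x-1,\ 0\le n\le N-1,$$ with homogeneous Dirichlet boundary conditions $u_0^n=u_{N_x}^n=0$, and write $u_j^n=p_j^n+\mathbf i q_j^n$, $v_j^n=\delta_x^+p_j^n$, $w_j^n=\delta_x^+q_j^n$, $z_j^n=(p_j^n,q_j^n,v_j^n,w_j^n)^T$. Then the scheme is a stochastic multi-symplectic integrator, i.e. it satisfies the discrete stochastic multi-symplectic conservation law $$\delta_t^+\big(dz_j^n\wedge M^+dz_j^n\big)+\delta_x^+\big(dz_{j-1}^{n+\frac12}\wedge K^-dz_j^{n+\frac12}\big)\frac{\delta W_n}{\delta t}=0,\quad\text{a.s.},$$ where $$M^+=\begin{pmatrix}0&-1&0&0\\0&0&0&0\\0&0&0&0\\0&0&0&0\end{pmatrix},\qquad K^-=\begin{pmatrix}0&0&0&0\\0&0&0&0\\-1&0&0&0\\0&-1&0&0\end{pmatrix}.$$ Moreover, the scheme preserves the discrete charge conservation law $$\delta x\sum_j|u_j^{n+1}|^2=\delta x\sum_j|u_j^n|^2,\quad\text{a.s.}$$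
   Context: $W$ is a one-dimensional real-valued Brownian motion on a stochastic basis, $T>0$, $N\ge1$, $\delta t=T/N$, $t_n=n\,\delta t$, $\delta W_n=W(t_{n+1})-W(t_n)$, $\mathbf i$ is the imaginary unit, and $\sigma\le2$ is a positive integer. The spatial domain is $[-L_x,L_x]$ with mesh step $\delta x=2L_x/N_x$ and grid points $x_j=-L_x+j\,\delta x$, $0\le j\le N_x$; $u_j^n\in\mathbb C$ approximates $u(t_n,x_j)$, where $\mathbf i\,du+\Delta u\circ dW+|u|^{2\sigma}u\,dt=0$ (Stratonovich noise). Difference operators: $\delta_t^+f^n=(f^{n+1}-f^n)/\delta t$, $\delta_x^+f_j=(f_{j+1}-f_j)/\delta x$, $\delta_x^-f_j=(f_j-f_{j-1})/\delta x$; half-step values are averages, $f^{n+\frac12}=\frac12(f^n+f^{n+1})$ (for $u_j$ as well as $z_j$). In $\delta_x^+\big(dz_{j-1}\wedge K^-dz_j\big)$ the operator shifts $j$ in both factors. With $z_j^n$ as in the claim the scheme is equivalent to $$M\delta_t^+z_j^n+K^+\delta_x^-z_j^{n+\frac12}\frac{\delta W_n}{\delta t}+K^-\delta_x^+z_j^{n+\frac12}\frac{\delta W_n}{\delta t}=\nabla_zS_1(z_j^{n+\frac12})+\nabla_zS_2(z_j^{n+\frac12})\frac{\delta W_n}{\delta t},$$ where $S_1(z)=-\frac1{2\sigma+2}(p^2+q^2)^{\sigma+1}$, $S_2(z)=-\frac12(v^2+w^2)$, $M$ is the $4\times4$ matrix with $M_{12}=-1$, $M_{21}=1$ and other entries $0$,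 and $K^+$ the one with $K^+_{13}=K^+_{24}=1$ and other entries $0$. $d$ denotes the exterior differential on the phase space, i.e. differentiation with respect to the initial data: $dz_j^n$ is a vector of one-forms whose value on a variation of the initial data is the corresponding variation of $z_j^n$. For a $4\times4$ matrix $A$ and vectors of one-forms $\alpha,\beta$, $\alpha\wedge A\beta:=\sum_{k,l}A_{kl}\,\alpha_k\wedge\beta_l$, with $(\alpha_k\wedge\beta_l)(\xi,\eta)=\alpha_k(\xi)\beta_l(\eta)-\alpha_k(\eta)\beta_l(\xi)$. *)

theory Defs
  imports "HOL-Probability.Probability"
begin

text \<open>
  The filtration is indexed by all reals, as in the library; only nonnegative times matter
  (a filtration on \<open>[0,\<infinity>)\<close> extends constantly to negative times).
\<close>

locale stochastic_basis = prob_space M + filtration "space M" F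
  for M :: "'w measure" and F :: "real \<Rightarrow> 'w measure" +
  assumes sub: "\<And>t. subalgebra M (F t)"

locale brownian_motion = stochastic_basis M F
  for M :: "'w measure" and F :: "real \<Rightarrow> 'w measure" +
  fixes W :: "real \<Rightarrow> 'w \<Rightarrow> real"
  assumes adapted: "\<And>t. 0 \<le> t \<Longrightarrow> W t \<in> borel_measurable (F t)"
    and start: "AE \<omega> in M. W 0 \<omega> = 0"
    and continuous_paths: "AE \<omega> in M. continuous_on {0..} (\<lambda>t. W t \<omega>)"
    and gaussian_increments: "\<And>s t. 0 \<le> s \<Longrightarrow> s < t \<Longrightarrow>
      distributed M lborel (\<lambda>\<omega>. W t \<omega> - W s \<omega>) (normal_density 0 (sqrt (t - s)))"
    and independent_increments: "\<And>s t. 0 \<le> s \<Longrightarrow> s < t \<Longrightarrow>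
      indep_set (sets (F s))
        {(\<lambda>\<omega>. W t \<omega> - W s \<omega>) -` B \<inter> space M |B. B \<in> sets borel}"

definition increment :: "(real \<Rightarrow> 'w \<Rightarrow> real) \<Rightarrow> real \<Rightarrow> nat \<Rightarrow> 'w \<Rightarrow> real" where
  "increment W dt n \<omega> = W (real (Suc n) * dt) \<omega> - W (real n * dt) \<omega>"

definition fwd_diff :: "real \<Rightarrow> (nat \<Rightarrow> 'a::real_vector) \<Rightarrow> nat \<Rightarrow> 'a" where
  "fwd_diff h f n = (f (n + 1) - f n) /\<^sub>R h"

definition bwd_diff :: "real \<Rightarrow> (nat \<Rightarrow> 'a::real_vector) \<Rightarrow> nat \<Rightarrow> 'a" where
  "bwd_diff h f j = (f j - f (j - 1)) /\<^sub>R h"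

definition half_step :: "(nat \<Rightarrow> 'a::real_vector) \<Rightarrow> nat \<Rightarrow> 'a" where
  "half_step f n = (1 / 2) *\<^sub>R (f n + f (n + 1))"

text \<open>
  A grid function \<open>u n j\<close> carries the time index first. The sequence \<open>dW\<close> holds the
  Brownian increments along one fixed path.
\<close>

definition scheme_solution ::
  "real \<Rightarrow> real \<Rightarrow> nat \<Rightarrow> nat \<Rightarrow> nat \<Rightarrow> (nat \<Rightarrow> real) \<Rightarrow> (nat \<Rightarrow> nat \<Rightarrow> complex) \<Rightarrow> bool" where
  "scheme_solution dt dx N Nx \<sigma> dW u \<longleftrightarrow>
     (\<forall>n\<le>N. u n 0 = 0 \<and> u n Nx = 0) \<and>
     (\<forall>n<N. \<forall>j\<in>{1..<Nx}.
        \<i> * fwd_diff dt (\<lambda>m. u m j) n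
        + complex_of_real (dW n / dt) *
            fwd_diff dx (bwd_diff dx (\<lambda>i. half_step (\<lambda>m. u m i) n)) j
        + complex_of_real (cmod (half_step (\<lambda>m. u m j) n) ^ (2 * \<sigma>)) *
            half_step (\<lambda>m. u m j) n = 0)"

definition state :: "real \<Rightarrow> (nat \<Rightarrow> complex) \<Rightarrow> nat \<Rightarrow> real ^ 4" where
  "state dx f j = vector [Re (f j), Im (f j),
     fwd_diff dx (\<lambda>i. Re (f i)) j, fwd_diff dx (\<lambda>i. Im (f i)) j]"

definition M_plus :: "real ^ 4 ^ 4" where
  "M_plus = vector [vector [0, -1, 0, 0],
                    vector [0,  0, 0, 0],
                    vector [0,  0, 0, 0],
                    vector [0,  0, 0, 0]]"

definition K_minus :: "real ^ 4 ^ 4" where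
  "K_minus = vector [vector [ 0,  0, 0, 0],
                     vector [ 0,  0, 0, 0],
                     vector [-1,  0, 0, 0],
                     vector [ 0, -1, 0, 0]]"

text \<open>
  The exterior differential at the point \<open>a\<close> of a vector-valued function on the phase space
  \<open>'e\<close>: component \<open>k\<close> is the one-form sending a variation \<open>\<xi>\<close> to the
  derivative of the \<open>k\<close>-th component along \<open>\<xi>\<close>.
\<close>

definition ext_d :: "('e::real_normed_vector \<Rightarrow> real ^ 'k) \<Rightarrow> 'e \<Rightarrow> 'k \<Rightarrow> 'e \<Rightarrow> real" where
  "ext_d f a k \<xi> = frechet_derivative (\<lambda>b. f b $ k) (at a) \<xi>"

definition wedge :: "('e \<Rightarrow> real) \<Rightarrow> ('e \<Rightarrow> real) \<Rightarrow> 'e \<Rightarrow> 'e \<Rightarrow> real" where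
  "wedge \<alpha> \<beta> \<xi> \<eta> = \<alpha> \<xi> * \<beta> \<eta> - \<alpha> \<eta> * \<beta> \<xi>"

definition wedge_mat ::
  "('k::finite \<Rightarrow> 'e \<Rightarrow> real) \<Rightarrow> real ^ 'k ^ 'k \<Rightarrow> ('k \<Rightarrow> 'e \<Rightarrow> real) \<Rightarrow> 'e \<Rightarrow> 'e \<Rightarrow> real" where
  "wedge_mat \<alpha> A \<beta> \<xi> \<eta> = (\<Sum>k\<in>UNIV. \<Sum>l\<in>UNIV. A $ k $ l * wedge (\<alpha> k) (\<beta> l) \<xi> \<eta>)"

text \<open>
  Initial data are the values of \<open>u 0\<close> at the interior nodes, i.e. points of \<open>complex ^ 'm\<close>,
  where \<open>node\<close> labels the interior nodes by \<open>'m\<close>. For one fixed path, \<open>U\<close> assigns to every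
  initial datum in the open set \<open>D\<close> a solution of the scheme, differentiably. The scheme is
  implicit, so such a map is only a selection of solutions: existence on the whole phase space,
  uniqueness and differentiability are not automatic for arbitrary step sizes.
\<close>

definition differentiable_solution_map ::
  "(nat \<Rightarrow> 'm::finite) \<Rightarrow> real \<Rightarrow> real \<Rightarrow> nat \<Rightarrow> nat \<Rightarrow> nat \<Rightarrow> (nat \<Rightarrow> real) \<Rightarrow>
   (complex ^ 'm) set \<Rightarrow> (complex ^ 'm \<Rightarrow> nat \<Rightarrow> nat \<Rightarrow> complex) \<Rightarrow> bool" where
  "differentiable_solution_map node dt dx N Nx \<sigma> dW D U \<longleftrightarrow>
     open D \<and>
     (\<forall>a\<in>D. scheme_solution dt dx N Nx \<sigma> dW (U a) \<and>
        (\<forall>j\<in>{1..<Nx}. U a 0 j = a $ node j) \<and>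
        (\<forall>n\<le>N. \<forall>j\<in>{1..<Nx}. (\<lambda>b. U b n j) differentiable (at a)))"

text \<open>
  The discrete multi-symplectic conservation law at the initial datum \<open>a\<close>, as an identity of
  two-forms. At \<open>j = Nx - 1\<close> the components \<open>v\<close>, \<open>w\<close> of the state at \<open>Nx\<close> would involve a
  value beyond the boundary; they only meet zero entries of the matrix.
\<close>

definition multi_symplectic_law ::
  "real \<Rightarrow> real \<Rightarrow> nat \<Rightarrow> nat \<Rightarrow> (nat \<Rightarrow> real) \<Rightarrow>
   ('e::real_normed_vector \<Rightarrow> nat \<Rightarrow> nat \<Rightarrow> complex) \<Rightarrow> 'e \<Rightarrow> bool" where
  "multi_symplectic_law dt dx N Nx dW U a \<longleftrightarrow>
     (let dz = (\<lambda>n j. ext_d (\<lambda>b. state dx (U b n) j) a);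
          dz_half = (\<lambda>n j. ext_d (\<lambda>b. half_step (\<lambda>m. state dx (U b m) j) n) a)
      in \<forall>n<N. \<forall>j\<in>{1..<Nx}. \<forall>\<xi> \<eta>.
           fwd_diff dt (\<lambda>m. wedge_mat (dz m j) M_plus (dz m j) \<xi> \<eta>) n
           + fwd_diff dx (\<lambda>i. wedge_mat (dz_half n (i - 1)) K_minus (dz_half n i) \<xi> \<eta>) j
               * (dW n / dt) = 0)"

definition charge :: "real \<Rightarrow> nat \<Rightarrow> (nat \<Rightarrow> complex) \<Rightarrow> real" where
  "charge dx Nx f = dx * (\<Sum>j=0..Nx. (cmod (f j))\<^sup>2)"

end

theory Submission
  imports Defs
begin

text \<open>
  Both laws hold pathwise and locally in space. Multiplying the scheme by the conjugate half-step
  value and taking imaginary parts removes the nonlinearity and turns the discrete Laplacian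
  into a telescoping flux; summation over \<open>j\<close> gives charge conservation. For the
  multi-symplectic law, linearise the scheme along two variations \<open>\<xi>\<close>, \<open>\<eta>\<close>, pair each
  linearisation with the half-step variation of the other in the real inner product of \<open>\<complex>\<close>,
  and subtract: the nonlinearity drops out because its derivative, being the Hessian of a
  potential, is self-adjoint, and the time difference produces the symplectic form
  \<open>Re x * Im y - Re y * Im x = (\<i> * x) \<bullet> y\<close>.
\<close>

lemma fwd_bwd_diff:
  "fwd_diff h (bwd_diff h f) j = (f (j + 1) - 2 *\<^sub>R f j + f (j - 1)) /\<^sub>R h\<^sup>2"
  by (simp add: fwd_diff_def bwd_diff_def power2_eq_square scaleR_2 algebra_simps)

lemma vector_4:
  "vector [w, x, y, z] $ (1 :: 4) = w"
  "vector [w, x, y, z] $ (2 :: 4) = x"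
  "vector [w, x, y, z] $ (3 :: 4) = y"
  "vector [w, x, y, z] $ (4 :: 4) = z"
  unfolding vector_def by simp_all

text \<open>Time averaging is linear and commutes with the spatial differences. Hence the same
  formulas for \<open>ext_d\<close> of a state serve at full and at half time steps.\<close>

lemma state_half_step:
  "half_step (\<lambda>m. state dx (u m) j) n = state dx (\<lambda>i. half_step (\<lambda>m. u m i) n) j"
  by (simp add: vec_eq_iff forall_4 vector_4 state_def half_step_def fwd_diff_def
      add_divide_distrib diff_divide_distrib algebra_simps)

lemma wedge_mat_M_plus: "wedge_mat \<alpha> M_plus \<beta> \<xi> \<eta> = - wedge (\<alpha> 1) (\<beta> 2) \<xi> \<eta>"
  by (simp add: wedge_mat_def M_plus_def sum_4 vector_4)

lemma wedge_mat_K_minus: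
  "wedge_mat \<alpha> K_minus \<beta> \<xi> \<eta> = - wedge (\<alpha> 3) (\<beta> 1) \<xi> \<eta> - wedge (\<alpha> 4) (\<beta> 2) \<xi> \<eta>"
  by (simp add: wedge_mat_def K_minus_def sum_4 vector_4)

section \<open>Exterior differentials of the state components\<close>

lemma ext_d_eqI:
  assumes "((\<lambda>b. f b $ k) has_derivative f') (at a)"
  shows "ext_d f a k = f'"
  using frechet_derivative_at[OF assms] by (auto simp: ext_d_def fun_eq_iff)

lemma ext_d_state:
  assumes "((\<lambda>b. f b j) has_derivative f' j) (at a)"
  shows "ext_d (\<lambda>b. state dx (f b) j) a 1 = (\<lambda>\<xi>. Re (f' j \<xi>))"
    and "ext_d (\<lambda>b. state dx (f b) j) a 2 = (\<lambda>\<xi>. Im (f' j \<xi>))"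
  by (rule ext_d_eqI, simp add: state_def vector_4, intro derivative_intros assms)+

text \<open>The components \<open>v\<close>, \<open>w\<close> reach the node \<open>j + 1\<close>,
  so its derivative enters too. Kept apart from \<open>p\<close>, \<open>q\<close>, whose
  differentials thus remain available at the last node \<open>Nx\<close>.\<close>

lemma ext_d_state_diff:
  assumes "((\<lambda>b. f b j) has_derivative f' j) (at a)"
    and "((\<lambda>b. f b (j + 1)) has_derivative f' (j + 1)) (at a)"
  shows "ext_d (\<lambda>b. state dx (f b) j) a 3 = (\<lambda>\<xi>. fwd_diff dx (\<lambda>i. Re (f' i \<xi>)) j)"
    and "ext_d (\<lambda>b. state dx (f b) j) a 4 = (\<lambda>\<xi>. fwd_diff dx (\<lambda>i. Im (f' i \<xi>)) j)"
  unfolding fwd_diff_def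
  by (rule ext_d_eqI, simp only: state_def vector_4 fwd_diff_def, intro derivative_intros assms)+

section \<open>The variational equation of the scheme\<close>

text \<open>The derivative appears as a real multiple of the identity plus a real multiple of the
  rank-one map sending \<open>\<zeta>\<close> to \<open>(z \<bullet> \<zeta>) *\<^sub>R z\<close>;
  in this form its self-adjointness is visible.\<close>

lemma has_derivative_power_nonlinearity:
  fixes z :: complex
  shows "((\<lambda>z. complex_of_real (cmod z ^ (2 * \<sigma>)) * z) has_derivative
     (\<lambda>\<zeta>. complex_of_real (cmod z ^ (2 * \<sigma>)) * \<zeta>
        + complex_of_real (2 * real \<sigma> * cmod z ^ (2 * (\<sigma> - 1)) * (z \<bullet> \<zeta>)) * z)) (at z)"
proof -
  \<comment> \<open>Unlike the norm, \<open>z \<bullet> z\<close> is differentiable at the origin as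
    well, so no case distinction at \<open>z = 0\<close> arises.\<close>
  have eq: "cmod z ^ (2 * k) = (z \<bullet> z) ^ k" for z :: complex and k
    by (simp add: power_mult power2_norm_eq_inner)
  show ?thesis
    unfolding eq
    by (rule has_derivative_eq_rhs, (rule derivative_intros)+)
       (auto simp: fun_eq_iff inner_commute algebra_simps)
qed

lemma linearised_scheme:
  assumes sol: "\<And>b. b \<in> D \<Longrightarrow> scheme_solution dt dx N Nx \<sigma> dW (U b)"
    and D: "open D" "a \<in> D" and n: "n < N" and j: "j \<in> {1..<Nx}"
    and der: "\<And>m i. m \<le> N \<Longrightarrow> i \<le> Nx \<Longrightarrow> ((\<lambda>b. U b m i) has_derivative X m i) (at a)"
  defines "h \<equiv> half_step (\<lambda>m. U a m j) n"
    and "H \<equiv> \<lambda>i \<xi>. half_step (\<lambda>m. X m i \<xi>) n"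
  shows "\<i> * fwd_diff dt (\<lambda>m. X m j \<xi>) n
     + complex_of_real (dW n / dt) * ((H (j + 1) \<xi> - 2 *\<^sub>R H j \<xi> + H (j - 1) \<xi>) /\<^sub>R dx\<^sup>2)
     + (complex_of_real (cmod h ^ (2 * \<sigma>)) * H j \<xi>
        + complex_of_real (2 * real \<sigma> * cmod h ^ (2 * (\<sigma> - 1)) * (h \<bullet> H j \<xi>)) * h) = 0"
    (is "?L \<xi> = 0")
proof -
  have half: "((\<lambda>b. half_step (\<lambda>m. U b m i) n) has_derivative H i) (at a)" if "i \<le> Nx" for i
    unfolding half_step_def H_def using that n
    by (intro has_derivative_add has_derivative_scaleR_right der) auto
  have nonlin: "((\<lambda>b. complex_of_real (cmod (half_step (\<lambda>m. U b m j) n) ^ (2 * \<sigma>)) *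
      half_step (\<lambda>m. U b m j) n) has_derivative
      (\<lambda>\<xi>. complex_of_real (cmod h ^ (2 * \<sigma>)) * H j \<xi>
        + complex_of_real (2 * real \<sigma> * cmod h ^ (2 * (\<sigma> - 1)) * (h \<bullet> H j \<xi>)) * h)) (at a)"
    unfolding h_def
    by (rule has_derivative_compose[OF half has_derivative_power_nonlinearity])
      (use j in auto)
  have time: "((\<lambda>b. \<i> * fwd_diff dt (\<lambda>m. U b m j) n) has_derivative
      (\<lambda>\<xi>. \<i> * fwd_diff dt (\<lambda>m. X m j \<xi>) n)) (at a)"
    unfolding fwd_diff_def using j n
    by (intro has_derivative_mult_right has_derivative_scaleR_right has_derivative_diff der) auto
  have space: "((\<lambda>b. complex_of_real (dW n / dt) * ((half_step (\<lambda>m. U b m (j + 1)) n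
        - 2 *\<^sub>R half_step (\<lambda>m. U b m j) n + half_step (\<lambda>m. U b m (j - 1)) n) /\<^sub>R dx\<^sup>2))
      has_derivative (\<lambda>\<xi>. complex_of_real (dW n / dt) *
        ((H (j + 1) \<xi> - 2 *\<^sub>R H j \<xi> + H (j - 1) \<xi>) /\<^sub>R dx\<^sup>2))) (at a)"
    using j by (intro has_derivative_mult_right has_derivative_scaleR_right has_derivative_add
        has_derivative_diff half) auto
  let ?E = "\<lambda>b. \<i> * fwd_diff dt (\<lambda>m. U b m j) n
     + complex_of_real (dW n / dt) *
         fwd_diff dx (bwd_diff dx (\<lambda>i. half_step (\<lambda>m. U b m i) n)) j
     + complex_of_real (cmod (half_step (\<lambda>m. U b m j) n) ^ (2 * \<sigma>)) *
         half_step (\<lambda>m. U b m j) n"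
  have "(?E has_derivative ?L) (at a)"
    unfolding fwd_bwd_diff by (intro has_derivative_add time space nonlin)
  \<comment> \<open>The residual \<open>?E\<close> vanishes on the whole open set \<open>D\<close>,
    not only at \<open>a\<close>, so its derivative is zero; uniqueness of derivatives gives the
    variational equation.\<close>
  moreover have "(?E has_derivative (\<lambda>_. 0)) (at a)"
  proof (rule has_derivative_transform_within_open[OF has_derivative_const D])
    show "0 = ?E b" if "b \<in> D" for b
      using sol[OF that] n j by (simp add: scheme_solution_def)
  qed
  ultimately have "?L = (\<lambda>_. 0)"
    by (rule has_derivative_unique)
  then show ?thesis
    by (rule fun_cong[where f = ?L and g = "\<lambda>_. 0" and x = \<xi>])
qed

section \<open>The multi-symplectic law\<close>

text \<open>The right-hand side is a discrete Green formula: in the antisymmetrised pairing with the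
  second difference the central terms cancel, and a difference of edge fluxes remains. Later
  \<open>c\<close> is \<open>dW n / dt\<close> and \<open>r\<close> is
  \<open>dx\<^sup>2\<close>.\<close>

lemma symplectic_balance:
  fixes h :: complex and X Y P Q :: "nat \<Rightarrow> complex"
  assumes X: "\<i> * fwd_diff dt X n + complex_of_real c * ((P (j + 1) - 2 *\<^sub>R P j + P (j - 1)) /\<^sub>R r)
      + (complex_of_real s * P j + complex_of_real (t * (h \<bullet> P j)) * h) = 0"
    and Y: "\<i> * fwd_diff dt Y n + complex_of_real c * ((Q (j + 1) - 2 *\<^sub>R Q j + Q (j - 1)) /\<^sub>R r)
      + (complex_of_real s * Q j + complex_of_real (t * (h \<bullet> Q j)) * h) = 0"
    and P: "P j = half_step X n" and Q: "Q j = half_step Y n"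
  shows "fwd_diff dt (\<lambda>m. Re (X m) * Im (Y m) - Re (Y m) * Im (X m)) n
    = c / r * ((P j \<bullet> Q (j + 1) - Q j \<bullet> P (j + 1)) - (P (j - 1) \<bullet> Q j - Q (j - 1) \<bullet> P j))"
proof -
  \<comment> \<open>The discrete Leibniz rule for a bilinear form, exact because the other factor is
    the midpoint average.\<close>
  have "fwd_diff dt (\<lambda>m. Re (X m) * Im (Y m) - Re (Y m) * Im (X m)) n
    = (\<i> * fwd_diff dt X n) \<bullet> Q j - (\<i> * fwd_diff dt Y n) \<bullet> P j"
    unfolding P Q by (simp add: fwd_diff_def half_step_def inner_complex_def algebra_simps)
  also have "\<i> * fwd_diff dt X n = - (complex_of_real c * ((P (j + 1) - 2 *\<^sub>R P j + P (j - 1)) /\<^sub>R r)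
      + (complex_of_real s * P j + complex_of_real (t * (h \<bullet> P j)) * h))"
    using X by (simp only: add.assoc eq_neg_iff_add_eq_0)
  also have "\<i> * fwd_diff dt Y n = - (complex_of_real c * ((Q (j + 1) - 2 *\<^sub>R Q j + Q (j - 1)) /\<^sub>R r)
      + (complex_of_real s * Q j + complex_of_real (t * (h \<bullet> Q j)) * h))"
    using Y by (simp only: add.assoc eq_neg_iff_add_eq_0)
  finally show ?thesis
    \<comment> \<open>Real coefficients become scalars, so bilinearity applies. The \<open>s\<close>
      terms cancel by symmetry of the inner product; both \<open>t\<close> terms equal
      \<open>t * (h \<bullet> P j) * (h \<bullet> Q j)\<close>.\<close>
    by (simp add: scaleR_conv_of_real[symmetric] inner_simps)
      (simp add: inner_commute divide_inverse algebra_simps)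
qed

lemma multi_symplectic_law_of_differentiable_solution_map:
  fixes U :: "complex ^ 'm::finite \<Rightarrow> nat \<Rightarrow> nat \<Rightarrow> complex"
  assumes map: "differentiable_solution_map node dt dx N Nx \<sigma> dW D U"
    and a: "a \<in> D"
  shows "multi_symplectic_law dt dx N Nx dW U a"
proof -
  have D: "open D" and sol: "\<And>b. b \<in> D \<Longrightarrow> scheme_solution dt dx N Nx \<sigma> dW (U b)"
    using map by (auto simp: differentiable_solution_map_def)
  define X where "X = (\<lambda>m i. frechet_derivative (\<lambda>b. U b m i) (at a))"
  define H where "H = (\<lambda>n i \<xi>. half_step (\<lambda>m. X m i \<xi>) n)"
  have der: "((\<lambda>b. U b m i) has_derivative X m i) (at a)" if "m \<le> N" "i \<le> Nx" for m i
  proof -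
    have "(\<lambda>b. U b m i) differentiable (at a)"
    proof (cases "i \<in> {1..<Nx}")
      case True
      then show ?thesis
        using map a that by (auto simp: differentiable_solution_map_def)
    next
      case False
      \<comment> \<open>At the boundary nodes the Dirichlet condition makes the value constantly
        zero on \<open>D\<close>, hence differentiable.\<close>
      then have "i = 0 \<or> i = Nx"
        using that by auto
      then have "0 = U b m i" if "b \<in> D" for b
        using sol[OF that] \<open>m \<le> N\<close> by (auto simp: scheme_solution_def)
      then have "((\<lambda>b. U b m i) has_derivative (\<lambda>_. 0)) (at a)"
        by (rule has_derivative_transform_within_open[OF has_derivative_const D a])
      then show ?thesis
        by (rule differentiableI)
    qed
    then show ?thesis
      unfolding X_def by (simp add: frechet_derivative_works)
  qed
  have half: "((\<lambda>b. half_step (\<lambda>m. U b m i) n) has_derivative H n i) (at a)"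
    if "n < N" "i \<le> Nx" for n i
    unfolding half_step_def H_def using that
    by (intro has_derivative_add has_derivative_scaleR_right der) auto
  \<comment> \<open>In \<open>v\<close> at \<open>j - 1\<close> the part from node \<open>j\<close>
    is wedged with itself and cancels; only the product of neighbouring values remains. The same
    holds for \<open>w\<close>.\<close>
  have flux: "wedge_mat (ext_d (\<lambda>b. state dx (\<lambda>i. half_step (\<lambda>m. U b m i) n) (j - 1)) a) K_minus
      (ext_d (\<lambda>b. state dx (\<lambda>i. half_step (\<lambda>m. U b m i) n) j) a) \<xi> \<eta>
      = (H n (j - 1) \<xi> \<bullet> H n j \<eta> - H n (j - 1) \<eta> \<bullet> H n j \<xi>) / dx"
    if "n < N" "1 \<le> j" "j \<le> Nx" for n j \<xi> \<eta>
  proof -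
    \<comment> \<open>The upper neighbour of \<open>j - 1\<close> is \<open>j\<close>, as
      \<open>1 \<le> j\<close>; the form \<open>j - 1 + 1\<close> matches
      \<open>ext_d_state_diff\<close>.\<close>
    have 1: "((\<lambda>b. half_step (\<lambda>m. U b m (j - 1)) n) has_derivative H n (j - 1)) (at a)"
      and 2: "((\<lambda>b. half_step (\<lambda>m. U b m (j - 1 + 1)) n) has_derivative H n (j - 1 + 1)) (at a)"
      and 3: "((\<lambda>b. half_step (\<lambda>m. U b m j) n) has_derivative H n j) (at a)"
      using that by (auto intro!: half)
    show ?thesis
      unfolding wedge_mat_K_minus ext_d_state_diff[where f = "\<lambda>b i. half_step (\<lambda>m. U b m i) n" and f' = "H n"
            and j = "j - 1", OF 1 2]
        ext_d_state[where f = "\<lambda>b i. half_step (\<lambda>m. U b m i) n" and f' = "H n" and j = j, OF 3]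
        wedge_def fwd_diff_def
      using that by (simp add: inner_complex_def divide_inverse algebra_simps)
  qed
  have density: "wedge_mat (ext_d (\<lambda>b. state dx (U b m) j) a) M_plus
      (ext_d (\<lambda>b. state dx (U b m) j) a) \<xi> \<eta>
      = - (Re (X m j \<xi>) * Im (X m j \<eta>) - Re (X m j \<eta>) * Im (X m j \<xi>))"
    if "m \<le> N" "j \<le> Nx" for m j \<xi> \<eta>
    unfolding wedge_mat_M_plus wedge_def
      ext_d_state[where f = "\<lambda>b. U b m" and f' = "X m" and j = j, OF der[OF that]] by simp
  show ?thesis
    unfolding multi_symplectic_law_def Let_def state_half_step
  proof (intro allI impI ballI)
    fix n j \<xi> \<eta>
    assume n: "n < N" and j: "j \<in> {1..<Nx}"
    have H: "half_step (\<lambda>m. X m i \<xi>) n = H n i \<xi>" for n i \<xi>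
      by (simp add: H_def)
    note lin = linearised_scheme[where U = U and X = X and dW = dW and dt = dt and dx = dx
        and \<sigma> = \<sigma>, unfolded H, OF _ D a n j]
    \<comment> \<open>Both variations are taken at the same solution, so the two linearised
      equations share the coefficients of the nonlinearity.\<close>
    have balance: "fwd_diff dt (\<lambda>m. Re (X m j \<xi>) * Im (X m j \<eta>) - Re (X m j \<eta>) * Im (X m j \<xi>)) n
      = dW n / dt / dx\<^sup>2 * ((H n j \<xi> \<bullet> H n (j + 1) \<eta> - H n j \<eta> \<bullet> H n (j + 1) \<xi>)
          - (H n (j - 1) \<xi> \<bullet> H n j \<eta> - H n (j - 1) \<eta> \<bullet> H n j \<xi>))"
      by (rule symplectic_balance[where P = "\<lambda>i. H n i \<xi>" and Q = "\<lambda>i. H n i \<eta>", OF lin lin])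
        (simp_all add: H_def sol der)
    show "fwd_diff dt (\<lambda>m. wedge_mat (ext_d (\<lambda>b. state dx (U b m) j) a) M_plus
            (ext_d (\<lambda>b. state dx (U b m) j) a) \<xi> \<eta>) n
        + fwd_diff dx (\<lambda>i. wedge_mat
            (ext_d (\<lambda>b. state dx (\<lambda>i. half_step (\<lambda>m. U b m i) n) (i - 1)) a) K_minus
            (ext_d (\<lambda>b. state dx (\<lambda>i. half_step (\<lambda>m. U b m i) n) i) a) \<xi> \<eta>) j
          * (dW n / dt) = 0"
      (is "?time + ?space * _ = 0")
    proof -
      have "?time = - fwd_diff dt
          (\<lambda>m. Re (X m j \<xi>) * Im (X m j \<eta>) - Re (X m j \<eta>) * Im (X m j \<xi>)) n"
        using n j by (simp add: fwd_diff_def density algebra_simps)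
      \<comment> \<open>The flux is used at \<open>j\<close> and at \<open>j + 1\<close>, which may
        be \<open>Nx\<close>. One factor \<open>1 / dx\<close> comes from the flux, the other from
        the outer difference.\<close>
      moreover have "?space = ((H n j \<xi> \<bullet> H n (j + 1) \<eta> - H n j \<eta> \<bullet> H n (j + 1) \<xi>)
          - (H n (j - 1) \<xi> \<bullet> H n j \<eta> - H n (j - 1) \<eta> \<bullet> H n j \<xi>)) / dx\<^sup>2"
        unfolding fwd_diff_def using n j
        by (subst (1 2) flux) (auto simp: power2_eq_square divide_inverse algebra_simps)
      ultimately show ?thesis
        unfolding balance by simp
    qed
  qed
qed

section \<open>Conservation of charge\<close>

text \<open>A discrete continuity equation: \<open>Im (cnj (h (j - 1)) * h j)\<close> is the current
  through the edge from \<open>j - 1\<close> to \<open>j\<close>, up to a factor.\<close>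

lemma local_charge_balance:
  assumes sol: "scheme_solution dt dx N Nx \<sigma> dW u" and "dt \<noteq> 0" and "n < N" and "j \<in> {1..<Nx}"
  defines "h \<equiv> \<lambda>i. half_step (\<lambda>m. u m i) n"
  shows "(cmod (u (n + 1) j))\<^sup>2 - (cmod (u n j))\<^sup>2
    = - (2 * dW n / dx\<^sup>2) * (Im (cnj (h j) * h (j + 1)) - Im (cnj (h (j - 1)) * h j))"
proof -
  define s where "s = cmod (h j) ^ (2 * \<sigma>)"
  define r where "r = dW n / dt / dx\<^sup>2"
  have scheme: "\<i> * fwd_diff dt (\<lambda>m. u m j) n
      + complex_of_real (dW n / dt) * ((h (j + 1) - 2 *\<^sub>R h j + h (j - 1)) /\<^sub>R dx\<^sup>2)
      + complex_of_real s * h j = 0"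
    using assms unfolding scheme_solution_def fwd_bwd_diff h_def s_def by blast
  \<comment> \<open>The difference of squared moduli is twice the real part of the conjugate
    midpoint times the increment; the factor \<open>\<i>\<close> turns the real part into an
    imaginary one.\<close>
  have "(cmod (u (n + 1) j))\<^sup>2 - (cmod (u n j))\<^sup>2
      = 2 * dt * Im (cnj (h j) * (\<i> * fwd_diff dt (\<lambda>m. u m j) n))"
    unfolding cmod_power2 using \<open>dt \<noteq> 0\<close>
    by (simp add: h_def half_step_def fwd_diff_def power2_eq_square field_simps)
  also have "\<i> * fwd_diff dt (\<lambda>m. u m j) n
      = - (complex_of_real (dW n / dt) * ((h (j + 1) - 2 *\<^sub>R h j + h (j - 1)) /\<^sub>R dx\<^sup>2)
        + complex_of_real s * h j)"
    using scheme by (simp only: add.assoc eq_neg_iff_add_eq_0)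
  also have "\<dots> = - (r *\<^sub>R (h (j + 1) - 2 *\<^sub>R h j + h (j - 1)) + s *\<^sub>R h j)"
    by (simp add: r_def scaleR_conv_of_real divide_inverse mult.assoc)
  \<comment> \<open>The terms with \<open>h j\<close> give real multiples of
    \<open>cnj (h j) * h j\<close> and drop out. Conjugation turns the lower-neighbour term into
    minus the current at \<open>j\<close>.\<close>
  also have "2 * dt * Im (cnj (h j) * \<dots>)
      = - (2 * dt * r) * (Im (cnj (h j) * h (j + 1)) - Im (cnj (h (j - 1)) * h j))"
    by (simp add: algebra_simps)
  also have "2 * dt * r = 2 * dW n / dx\<^sup>2"
    using \<open>dt \<noteq> 0\<close> by (simp add: r_def)
  finally show ?thesis .
qed

lemma charge_conservation:
  assumes sol: "scheme_solution dt dx N Nx \<sigma> dW u" and "dt \<noteq> 0" and n: "n < N"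
  shows "charge dx Nx (u (n + 1)) = charge dx Nx (u n)"
proof (cases "Nx = 0")
  \<comment> \<open>Treated apart since the telescoping sum from 1 needs \<open>1 \<le> Nx\<close>;
    here the only node is a boundary node.\<close>
  case True
  then show ?thesis
    using sol n by (simp add: charge_def scheme_solution_def)
next
  case False
  have bd: "u m 0 = 0" "u m Nx = 0" if "m \<le> N" for m
    using sol that by (auto simp: scheme_solution_def)
  define h where "h = (\<lambda>i. half_step (\<lambda>m. u m i) n)"
  define A where "A = (\<lambda>j. Im (cnj (h (j - 1)) * h j))"
  have interior: "(\<Sum>j=0..Nx. (cmod (u m j))\<^sup>2) = (\<Sum>j=1..<Nx. (cmod (u m j))\<^sup>2)" if "m \<le> N" for m
    by (rule sum.mono_neutral_right) (use bd[OF that] in \<open>auto simp: not_less Suc_le_eq antisym\<close>)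
  have "(\<Sum>j=1..<Nx. (cmod (u (n + 1) j))\<^sup>2 - (cmod (u n j))\<^sup>2)
      = (\<Sum>j=1..<Nx. - (2 * dW n / dx\<^sup>2) * (A (Suc j) - A j))"
    by (rule sum.cong) (use local_charge_balance[OF sol \<open>dt \<noteq> 0\<close> n] in \<open>auto simp: A_def h_def\<close>)
  also have "\<dots> = - (2 * dW n / dx\<^sup>2) * (\<Sum>j=1..<Nx. A (Suc j) - A j)"
    by (rule sum_distrib_left[symmetric])
  also have "(\<Sum>j=1..<Nx. A (Suc j) - A j) = A Nx - A 1"
    using False by (intro sum_Suc_diff') simp
  \<comment> \<open>Each end current contains a boundary value, \<open>h 0\<close> or
    \<open>h Nx\<close>, which is zero.\<close>
  also have "A Nx - A 1 = 0"
    using bd n by (auto simp: A_def h_def half_step_def)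
  finally show ?thesis
    using n by (simp add: charge_def interior sum_subtractf)
qed

section \<open>Passage to almost every path\<close>

theorem theorem3p2:
  fixes M :: "'w measure" and F :: "real \<Rightarrow> 'w measure" and W :: "real \<Rightarrow> 'w \<Rightarrow> real"
    and T Lx dt dx :: real and N Nx \<sigma> :: nat
  assumes "brownian_motion M F W"
    and "T > 0" and "N \<ge> 1" and "dt = T / real N"
    and "Lx > 0" and "Nx \<ge> 1" and "dx = 2 * Lx / real Nx"
    and "1 \<le> \<sigma>" and "\<sigma> \<le> 2"
  shows "(\<forall>(node :: nat \<Rightarrow> 'm::finite) (D :: 'w \<Rightarrow> (complex ^ 'm) set) U.
            bij_betw node {1..<Nx} UNIV \<longrightarrow>
            (AE \<omega> in M. differentiable_solution_map node dt dx N Nx \<sigma>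
                           (\<lambda>n. increment W dt n \<omega>) (D \<omega>) (U \<omega>)) \<longrightarrow>
            (AE \<omega> in M. \<forall>a\<in>D \<omega>.
               multi_symplectic_law dt dx N Nx (\<lambda>n. increment W dt n \<omega>) (U \<omega>) a))
         \<and> (\<forall>u :: 'w \<Rightarrow> nat \<Rightarrow> nat \<Rightarrow> complex.
            (AE \<omega> in M. scheme_solution dt dx N Nx \<sigma> (\<lambda>n. increment W dt n \<omega>) (u \<omega>)) \<longrightarrow>
            (AE \<omega> in M. \<forall>n<N. charge dx Nx (u \<omega> (n + 1)) = charge dx Nx (u \<omega> n)))"
proof (intro conjI allI impI)
  fix node :: "nat \<Rightarrow> 'm" and D :: "'w \<Rightarrow> (complex ^ 'm) set" and U
  assume "AE \<omega> in M. differentiable_solution_map node dt dx N Nx \<sigma>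
    (\<lambda>n. increment W dt n \<omega>) (D \<omega>) (U \<omega>)"
  then show "AE \<omega> in M. \<forall>a\<in>D \<omega>.
      multi_symplectic_law dt dx N Nx (\<lambda>n. increment W dt n \<omega>) (U \<omega>) a"
    \<comment> \<open>The law is deterministic along each path, so the exceptional null set of the
      hypothesis serves for the conclusion.\<close>
    by eventually_elim (use multi_symplectic_law_of_differentiable_solution_map in blast)
next
  fix u :: "'w \<Rightarrow> nat \<Rightarrow> nat \<Rightarrow> complex"
  assume "AE \<omega> in M. scheme_solution dt dx N Nx \<sigma> (\<lambda>n. increment W dt n \<omega>) (u \<omega>)"
  then show "AE \<omega> in M. \<forall>n<N. charge dx Nx (u \<omega> (n + 1)) = charge dx Nx (u \<omega> n)"
  proof eventually_elim
    have "dt \<noteq> 0"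
      using assms(2-4) by simp
    then show "\<forall>n<N. charge dx Nx (u \<omega> (n + 1)) = charge dx Nx (u \<omega> n)"
      if "scheme_solution dt dx N Nx \<sigma> (\<lambda>n. increment W dt n \<omega>) (u \<omega>)" for \<omega>
      using charge_conservation[OF that] by blast
  qed
qed

end
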